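(* Let $L$ be a lattice and let $G\subseteq L$ be a generating set for $L$. If $g_1g_2$ has a CPR-factorization for every $g_1,g_2\in G\setminus\{1\}$, then $L$ is a treed lattice.
   Context: A multiplicative lattice is an ordered commutative monoid $(L,\le,\cdot)$ such that $(L,\le)$ is a complete lattice with top element $1$ and bottom element $0$, $0\ne 1$; $x(\bigvee Y)=\bigvee_{y\in Y}xy$ for all $x\in L$, $Y\subseteq L$; and $x1=x$ for all $x\in L$. An element $c\in L$ is compact if $c\le\bigvee H$ with $H\subseteq L$ implies $c\le\bigvee F$ for some finite $F\subseteq H$. A subset $G\subseteq L$ generates $L$ (is a generating set for $L$) if every element of $L$ is the join of some subset of $G$. Throughout, "lattice" means a multiplicative lattice $L$ such that (i) $1$ is compact, (ii) $L$ is generated by the set of its compact elements, (iii) every product of two compact elements is compact. An element $p\ne 1$ is prime if $xy\le p$ implies $x\le p$ or $y\le p$. The radical of $a\in L$ is $\sqrt{a}=\bigvee\{x\in L : x^n\le a \text{ for some } n\ge 1\}$. Elements $a,b\in L$ are comaximal if $a\vee b=1$. For $a\in L\setminus\{1\}$, a CPR-factorization (comaximal prime radical factorization) of $a$ is a factorization $a=a_1\cdots a_n$ ($n\ge1$) with $a_1,\dots,a_n\in L\setminus\{1\}$ pairwise comaximal such that each $\sqrt{a_i}$ is a prime element. $L$ is treed if its set of prime elements is a tree under $\le$, equivalently, any two incomparable prime elements of $L$ are comaximal. *)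

theory Defs
  imports Main
begin

section \<open>Multiplicative lattices\<close>

definition (in complete_lattice) compact_element :: "'a \<Rightarrow> bool" where
  "compact_element c \<longleftrightarrow>
     (\<forall>H. c \<le> Sup H \<longrightarrow> (\<exists>F. finite F \<and> F \<subseteq> H \<and> c \<le> Sup F))"

definition (in complete_lattice) generates :: "'a set \<Rightarrow> bool" where
  "generates G \<longleftrightarrow> (\<forall>x. \<exists>S. S \<subseteq> G \<and> x = Sup S)"

text \<open>
  The monoid unit \<open>1\<close> is the top element and the lattice zero is \<open>bot\<close>.
  The axiom \<open>mult_le_mono_right\<close> (the monoid is ordered) also follows from \<open>mult_Sup\<close>.
\<close>
class mult_lattice = complete_lattice + comm_monoid_mult +
  assumes one_eq_top: "1 = top"
    and bot_neq_one: "bot \<noteq> 1"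
    and mult_le_mono_right: "x \<le> y \<Longrightarrow> z * x \<le> z * y"
    and mult_Sup: "x * Sup Y = Sup ((\<lambda>y. x * y) ` Y)"

class compact_mult_lattice = mult_lattice +
  assumes compact_one: "compact_element 1"
    and generates_compact: "generates {c. compact_element c}"
    and compact_mult: "compact_element c \<Longrightarrow> compact_element d \<Longrightarrow> compact_element (c * d)"


section \<open>Prime elements, radicals, comaximality\<close>

definition prime_element :: "'a::mult_lattice \<Rightarrow> bool" where
  "prime_element p \<longleftrightarrow> p \<noteq> 1 \<and> (\<forall>x y. x * y \<le> p \<longrightarrow> x \<le> p \<or> y \<le> p)"

definition radical :: "'a::mult_lattice \<Rightarrow> 'a" where
  "radical a = Sup {x. \<exists>n\<ge>1. x ^ n \<le> a}"

definition comaximal :: "'a::mult_lattice \<Rightarrow> 'a \<Rightarrow> bool" where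
  "comaximal a b \<longleftrightarrow> sup a b = 1"


section \<open>Comaximal prime radical factorizations\<close>

text \<open>The factors \<open>a\<^sub>1, \<dots>, a\<^sub>n\<close> form a list; comaximality is required for distinct indices.\<close>
definition CPR_factorization :: "'a::mult_lattice list \<Rightarrow> 'a \<Rightarrow> bool" where
  "CPR_factorization as a \<longleftrightarrow>
     as \<noteq> [] \<and> a = prod_list as \<and>
     (\<forall>i < length as. as ! i \<noteq> 1 \<and> prime_element (radical (as ! i))) \<and>
     (\<forall>i < length as. \<forall>j < length as. i \<noteq> j \<longrightarrow> comaximal (as ! i) (as ! j))"

definition has_CPR_factorization :: "'a::mult_lattice \<Rightarrow> bool" where
  "has_CPR_factorization a \<longleftrightarrow> a \<noteq> 1 \<and> (\<exists>as. CPR_factorization as a)"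


section \<open>Treed lattices\<close>

text \<open>
  A set is a tree under \<open>\<le>\<close> if the elements of the set below any given one form a chain.
  The lemma \<open>treed_iff_comaximal\<close> below gives the equivalent formulation that incomparable
  prime elements are comaximal.
\<close>
definition is_tree :: "'a::order set \<Rightarrow> bool" where
  "is_tree T \<longleftrightarrow> (\<forall>r\<in>T. \<forall>p\<in>T. \<forall>q\<in>T. p \<le> r \<longrightarrow> q \<le> r \<longrightarrow> p \<le> q \<or> q \<le> p)"

definition treed :: "'a::compact_mult_lattice itself \<Rightarrow> bool" where
  "treed (_ :: 'a itself) \<longleftrightarrow> is_tree {p :: 'a. prime_element p}"

lemma ex_prime_above:
  fixes a :: "'a::compact_mult_lattice"
  assumes "a \<noteq> 1"
  shows "\<exists>m. prime_element m \<and> a \<le> m"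
proof -
  have le1: "x \<le> 1" for x :: 'a by (simp add: one_eq_top)
  let ?A = "{x. x \<noteq> 1 \<and> a \<le> x}"
  have "\<exists>m\<in>?A. \<forall>x\<in>?A. m \<le> x \<longrightarrow> x = m"
  proof (rule predicate_Zorn[where P = "(\<le>)"])
    show "partial_order_on ?A (relation_of (\<le>) ?A)"
      by (rule partial_order_on_relation_ofI) auto
    fix C assume C: "C \<in> Chains (relation_of (\<le>) ?A)"
    have sub: "C \<subseteq> ?A" and tot: "\<And>x y. x \<in> C \<Longrightarrow> y \<in> C \<Longrightarrow> x \<le> y \<or> y \<le> x"
      using C unfolding Chains_def relation_of_def by blast+
    show "\<exists>u\<in>?A. \<forall>x\<in>C. x \<le> u"
    proof (cases "C = {}")
      case True
      then show ?thesis using assms by auto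
    next
      case False
      have "Sup C \<noteq> 1"
      proof
        assume "Sup C = 1"
        then obtain F where F: "finite F" "F \<subseteq> C" "1 \<le> Sup F"
          using compact_one unfolding compact_element_def by (metis order_refl)
        have "F \<noteq> {}" using F(3) bot_neq_one le1 by (metis Sup_empty antisym)
        from F(1) this F(2) have "\<exists>m\<in>F. \<forall>x\<in>F. x \<le> m"
        proof (induction F rule: finite_ne_induct)
          case (insert x F)
          then obtain m where m: "m \<in> F" "\<forall>x\<in>F. x \<le> m" by auto
          with insert.prems have "x \<le> m \<or> m \<le> x" using tot by blast
          then show ?case
          proof
            assume "x \<le> m"
            with m show ?thesis by auto
          next
            assume "m \<le> x"
            with m have "\<forall>y\<in>F. y \<le> x" by (blast intro: order_trans)
            then show ?thesis by auto
          qed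
        qed auto
        then obtain m where m: "m \<in> F" "\<forall>x\<in>F. x \<le> m" by blast
        then have "1 \<le> m" using order_trans[OF F(3) Sup_least] by blast
        then have "m = 1" by (rule order.antisym[OF le1])
        with m F(2) sub show False by blast
      qed
      moreover have "a \<le> Sup C" using False sub by (force intro: Sup_upper2)
      ultimately show ?thesis by (auto intro: Sup_upper)
    qed
  qed
  then obtain m where m: "m \<noteq> 1" "a \<le> m" "\<And>x. x \<noteq> 1 \<Longrightarrow> m \<le> x \<Longrightarrow> x = m"
    by (auto intro: order_trans)
  have mult_sup: "z * sup x y = sup (z * x) (z * y)" for x y z :: 'a
    using mult_Sup[of z "{x, y}"] by simp
  have mult_le: "x * y \<le> x" for x y :: 'a
    using mult_le_mono_right[OF le1, of x y] by simp
  have "x \<le> m \<or> y \<le> m" if xy: "x * y \<le> m" for x y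
  proof (rule ccontr)
    assume n: "\<not> (x \<le> m \<or> y \<le> m)"
    then have "sup m x = 1" "sup m y = 1" using m(3) by (metis sup_ge1 sup_ge2)+
    then have "1 = sup m x * sup m y" by simp
    also have "\<dots> = sup (sup m x * m) (sup (m * y) (x * y))"
      unfolding mult_sup mult.commute[of "sup m x" y] by (simp add: mult.commute)
    also have "\<dots> \<le> m"
      using xy mult_le[of m y] mult_le[of m "sup m x"] by (simp add: mult.commute)
    finally show False using m(1) le1 by (metis antisym)
  qed
  with m show ?thesis unfolding prime_element_def by blast
qed

lemma treed_iff_comaximal:
  "treed TYPE('a::compact_mult_lattice) \<longleftrightarrow>
     (\<forall>p q :: 'a. prime_element p \<longrightarrow> prime_element q \<longrightarrow>
        \<not> p \<le> q \<longrightarrow> \<not> q \<le> p \<longrightarrow> comaximal p q)"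
proof
  assume "treed TYPE('a)"
  then have T: "prime_element r \<Longrightarrow> prime_element p \<Longrightarrow> prime_element q \<Longrightarrow>
      p \<le> r \<Longrightarrow> q \<le> r \<Longrightarrow> p \<le> q \<or> q \<le> p" for r p q :: 'a
    unfolding treed_def is_tree_def by blast
  show "\<forall>p q :: 'a. prime_element p \<longrightarrow> prime_element q \<longrightarrow>
      \<not> p \<le> q \<longrightarrow> \<not> q \<le> p \<longrightarrow> comaximal p q"
  proof (intro allI impI)
    fix p q :: 'a
    assume A: "prime_element p" "prime_element q" "\<not> p \<le> q" "\<not> q \<le> p"
    show "comaximal p q"
    proof (rule ccontr)
      assume "\<not> comaximal p q"
      then have "sup p q \<noteq> 1" unfolding comaximal_def .
      then obtain m where "prime_element m" "sup p q \<le> m" using ex_prime_above by blast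
      with T[of m p q] A show False by simp
    qed
  qed
next
  assume R: "\<forall>p q :: 'a. prime_element p \<longrightarrow> prime_element q \<longrightarrow>
      \<not> p \<le> q \<longrightarrow> \<not> q \<le> p \<longrightarrow> comaximal p q"
  show "treed TYPE('a)"
    unfolding treed_def is_tree_def
  proof clarsimp
    fix r p q :: 'a
    assume A: "prime_element r" "prime_element p" "prime_element q" "p \<le> r" "q \<le> r" "\<not> q \<le> p"
    show "p \<le> q"
    proof (rule ccontr)
      assume "\<not> p \<le> q"
      with A R have "sup p q = 1" unfolding comaximal_def by blast
      moreover have "sup p q \<le> r" using A by simp
      ultimately have "r = 1" by (metis one_eq_top top.extremum_uniqueI)
      with A show False unfolding prime_element_def by blast
    qed
  qed
qed

end

theory Submission
  imports Defs
begin

text \<open>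
  Let \<open>p\<close> and \<open>q\<close> be incomparable primes below a common prime \<open>r\<close>. Since \<open>G\<close> generates the lattice,
  there are generators \<open>g\<^sub>1 \<le> p\<close> with \<open>g\<^sub>1 \<nleq> q\<close> and \<open>g\<^sub>2 \<le> q\<close> with \<open>g\<^sub>2 \<nleq> p\<close>; neither is \<open>1\<close>. In a
  CPR-factorization of \<open>g\<^sub>1g\<^sub>2\<close>, some factor lies below \<open>p\<close> and some factor lies below \<open>q\<close>. Both lie
  below \<open>r \<noteq> 1\<close>, so they are not comaximal, and hence they are one and the same factor \<open>a\<close>. Then the
  prime \<open>s = \<surd>a\<close> satisfies \<open>g\<^sub>1g\<^sub>2 \<le> a \<le> s \<le> p \<sqinter> q\<close>. Being prime, \<open>s\<close> lies above \<open>g\<^sub>1\<close> or \<open>g\<^sub>2\<close>, so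
  \<open>g\<^sub>1 \<le> q\<close> or \<open>g\<^sub>2 \<le> p\<close>, a contradiction.
\<close>

lemma le_one: "x \<le> (1::'a::mult_lattice)"
  by (simp add: one_eq_top)

lemma mult_le_left: "x * y \<le> (x::'a::mult_lattice)"
  using mult_le_mono_right[OF le_one, of x y] by simp

lemma prod_list_le_factor:
  fixes x :: "'a::mult_lattice"
  assumes "x \<in> set xs"
  shows "prod_list xs \<le> x"
  using assms
proof (induction xs)
  case (Cons y ys)
  show ?case
  proof (cases "x = y")
    case True
    then show ?thesis by (simp add: mult_le_left)
  next
    case False
    then have "prod_list ys \<le> x" using Cons by simp
    moreover have "prod_list (y # ys) \<le> prod_list ys"
      using mult_le_left[of "prod_list ys" y] by (simp add: mult.commute)
    ultimately show ?thesis by (rule order_trans[rotated])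
  qed
qed simp

lemma not_one_le_prime:
  assumes "prime_element p"
  shows "\<not> 1 \<le> p"
  using assms le_one[of p] order.antisym unfolding prime_element_def by blast

lemma prod_list_le_prime:
  assumes "prime_element p" and "prod_list xs \<le> p"
  shows "\<exists>x\<in>set xs. x \<le> p"
  using assms(2)
proof (induction xs)
  case Nil
  then show ?case using not_one_le_prime[OF assms(1)] by simp
next
  case (Cons x xs)
  then have "x \<le> p \<or> prod_list xs \<le> p"
    using assms(1) unfolding prime_element_def by simp
  then show ?case using Cons.IH by auto
qed

lemma power_le_prime:
  assumes "prime_element p" and "x ^ n \<le> p"
  shows "x \<le> p"
  using prod_list_le_prime[of p "replicate n x"] assms
  by (auto simp: prod_list_replicate)

lemma le_radical: "a \<le> radical a"
  unfolding radical_def by (rule Sup_upper) (auto intro: exI[of _ 1])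

lemma radical_le_prime:
  assumes "prime_element p" and "a \<le> p"
  shows "radical a \<le> p"
  unfolding radical_def
  using assms power_le_prime order_trans by (blast intro: Sup_least)

lemma generates_witness:
  fixes x y :: "'a::complete_lattice"
  assumes "generates G" and "\<not> x \<le> y"
  obtains g where "g \<in> G" "g \<le> x" "\<not> g \<le> y"
proof -
  obtain S where S: "S \<subseteq> G" "x = Sup S"
    using assms(1) unfolding generates_def by blast
  then obtain g where "g \<in> S" "\<not> g \<le> y"
    using assms(2) Sup_least[of S y] by blast
  then show thesis using that S Sup_upper by blast
qed

text \<open>
  Two factors at different positions are comaximal, so they cannot both lie below \<open>r \<noteq> 1\<close>. This
  forces the factors below \<open>p\<close> and below \<open>q\<close>, which exist by primeness, to coincide.
\<close>
lemma CPR_factorization_common_factor: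
  assumes cpr: "CPR_factorization as a"
    and r: "prime_element r" "p \<le> r" "q \<le> r"
    and p: "prime_element p" "a \<le> p"
    and q: "prime_element q" "a \<le> q"
  obtains b where "b \<in> set as" "b \<le> p" "b \<le> q" "prime_element (radical b)"
proof -
  have a: "a = prod_list as"
    using cpr unfolding CPR_factorization_def by blast
  obtain i where i: "i < length as" "as ! i \<le> p"
    using prod_list_le_prime[OF p(1)] p(2) a by (metis in_set_conv_nth)
  obtain j where j: "j < length as" "as ! j \<le> q"
    using prod_list_le_prime[OF q(1)] q(2) a by (metis in_set_conv_nth)
  have "sup (as ! i) (as ! j) \<le> r"
    using i(2) j(2) r(2,3) by (meson le_sup_iff order_trans)
  then have "\<not> comaximal (as ! i) (as ! j)"
    using not_one_le_prime[OF r(1)] unfolding comaximal_def by metis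
  then have "i = j"
    using cpr i(1) j(1) unfolding CPR_factorization_def by blast
  then show thesis
    using that[of "as ! i"] cpr i j unfolding CPR_factorization_def by simp
qed

theorem theorem12:
  fixes G :: "'a::compact_mult_lattice set"
  assumes "generates G"
    and "\<And>g1 g2. g1 \<in> G - {1} \<Longrightarrow> g2 \<in> G - {1} \<Longrightarrow> has_CPR_factorization (g1 * g2)"
  shows "treed TYPE('a)"
proof -
  have False
    if r: "prime_element r" "p \<le> r" "q \<le> r"
      and p: "prime_element p" and q: "prime_element q"
      and incomp: "\<not> p \<le> q" "\<not> q \<le> p"
    for r p q :: 'a
  proof -
    obtain g1 where g1: "g1 \<in> G" "g1 \<le> p" "\<not> g1 \<le> q"
      using generates_witness[OF assms(1) incomp(1)] .
    obtain g2 where g2: "g2 \<in> G" "g2 \<le> q" "\<not> g2 \<le> p"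
      using generates_witness[OF assms(1) incomp(2)] .
    have "g1 \<noteq> 1" "g2 \<noteq> 1"
      using g1(2) g2(2) not_one_le_prime p q by auto
    then have "has_CPR_factorization (g1 * g2)"
      using assms(2) g1(1) g2(1) by simp
    then obtain as where as: "CPR_factorization as (g1 * g2)"
      unfolding has_CPR_factorization_def by blast
    have "g1 * g2 \<le> p" "g1 * g2 \<le> q"
      using mult_le_left[of g1 g2] mult_le_left[of g2 g1] g1(2) g2(2)
      by (auto simp: mult.commute intro: order_trans)
    then obtain b where b: "b \<in> set as" "b \<le> p" "b \<le> q" "prime_element (radical b)"
      using CPR_factorization_common_factor[OF as r p _ q] by blast
    have "g1 * g2 \<le> b"
      using prod_list_le_factor[OF b(1)] as unfolding CPR_factorization_def by simp
    then have "g1 * g2 \<le> radical b"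
      using le_radical order_trans by blast
    then have "g1 \<le> radical b \<or> g2 \<le> radical b"
      using b(4) unfolding prime_element_def by blast
    moreover have "radical b \<le> p" "radical b \<le> q"
      using radical_le_prime b(2,3) p q by blast+
    ultimately show False
      using g1(3) g2(3) order_trans by blast
  qed
  then show ?thesis
    unfolding treed_def is_tree_def by blast
qed

end
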